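(* There is an absolute constant $C>0$ such that the following holds. Let $\mathcal X\subseteq\mathbb R^d$ be a nonempty closed bounded convex set with diameter $D=\max_{x,y\in\mathcal X}\|x-y\|$, and let $F:\mathcal X\to\mathbb R^d$ be a continuous operator that is monotone, i.e. $\langle F(x)-F(y),x-y\rangle\ge 0$ for all $x,y\in\mathcal X$, and $L_1$-smooth, i.e. $\|\nabla F(x)-\nabla F(y)\|_{\mathrm{op}}\le L_1\|x-y\|$ for all $x,y\in\mathcal X$. Let $\delta\ge 0$ and let $J(v)\in\mathbb R^{d\times d}$, $v\in\mathcal X$, be inexact Jacobians with $\|\nabla F(v)-J(v)\|\le\delta$. Then after $T\ge 1$ iterations of the algorithm VIJI with parameters $\beta_k=\delta$ for all $k$ and $\eta=10$, the averaged output $\tilde x_T=\frac{1}{\sum_{k=1}^T\lambda_k}\sum_{k=1}^T\lambda_k x_k$ (option $\mathsf{opt}=0$) satisfies $$\sup_{x\in\mathcal X}\langle F(x),\tilde x_T-x\rangle\le C\left(\frac{L_1D^3}{T^{3/2}}+\frac{\delta D^2}{T}\right).$$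
   Context: $\|\cdot\|$ is the Euclidean norm (operator norm for matrices). Inexact model: for $v\in\mathcal X$ and $\eta>0$, $\Psi_v(x)=F(v)+J(v)[x-v]$ and $\Omega_v^\eta(x)=\Psi_v(x)+\eta\delta(x-v)+5L_1\|x-v\|(x-v)$. Algorithm VIJI: given $x_0\in\mathcal X$, $L_1$, $\delta$, $\eta$ and a sequence $\{\beta_k\}$, set $s_0=0\in\mathbb R^d$ and for $k=0,1,2,\dots$: (1) $v_{k+1}=\arg\max_{v\in\mathcal X}\{\langle s_k,v-x_0\rangle-\frac12\|v-x_0\|^2\}$; (2) $x_{k+1}\in\mathcal X$ is any point with $\sup_{x\in\mathcal X}\langle\Omega^\eta_{v_{k+1}}(x_{k+1}),x_{k+1}-x\rangle\le\frac{L_1}{2}\|x_{k+1}-v_{k+1}\|^3+\delta\|x_{k+1}-v_{k+1}\|^2$; (3) $\lambda_{k+1}$ is any number with $\frac1{32}\le\lambda_{k+1}\left(\frac{L_1}{2}\|x_{k+1}-v_{k+1}\|+\beta_{k+1}\right)\le\frac1{22}$; (4) $s_{k+1}=s_k-\lambda_{k+1}F(x_{k+1})$. *)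

theory Defs
  imports "HOL-Analysis.Analysis"
begin

section \<open>Euclidean spaces of variable dimension\<close>

text \<open>
  The constant in the theorem must not depend on the dimension, so the dimension has to be a natural
  number quantified inside the formula and cannot be a type. All spaces \<open>\<real>\<^sup>d\<close> are therefore
  realised as subspaces of one inner product space: the finitely supported real sequences with the
  standard inner product. The space \<open>\<real>\<^sup>d\<close> consists of the sequences that vanish from index \<open>d\<close> on
  (coordinates are numbered from \<open>0\<close>); compare \<^const>\<open>Euclidean_space\<close>, which uses the same
  sequences but provides only the topology. The notions \<^const>\<open>norm\<close>, \<^const>\<open>inner\<close>,
  \<^const>\<open>convex\<close>, \<^const>\<open>closed\<close>, \<^const>\<open>has_derivative\<close> and so on of the ambient space
  restrict to the usual ones on \<open>\<real>\<^sup>d\<close>.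
\<close>

typedef rvec = "{f :: nat \<Rightarrow> real. finite {i. f i \<noteq> 0}}"
  morphisms coord Abs_rvec
  by (rule exI[of _ "\<lambda>_. 0"]) simp

lemma finite_support: "finite {i. coord x i \<noteq> 0}"
  using coord[of x] by simp

lemma rvec_eqI: "(\<And>i. coord x i = coord y i) \<Longrightarrow> x = y"
  by (meson coord_inject ext)

lemma coord_Abs_rvec: "finite {i. f i \<noteq> 0} \<Longrightarrow> coord (Abs_rvec f) i = f i"
  by (simp add: Abs_rvec_inverse)

instantiation rvec :: real_vector
begin

definition "0 = Abs_rvec (\<lambda>_. 0)"
definition "x + y = Abs_rvec (\<lambda>i. coord x i + coord y i)"
definition "x - y = Abs_rvec (\<lambda>i. coord x i - coord y i)"
definition "- x = Abs_rvec (\<lambda>i. - coord x i)"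
definition "scaleR r x = Abs_rvec (\<lambda>i. r * coord x i)"

lemma coord_zero: "coord 0 i = 0"
  by (simp add: zero_rvec_def coord_Abs_rvec)

lemma coord_add: "coord (x + y) i = coord x i + coord y i"
  unfolding plus_rvec_def
  by (rule coord_Abs_rvec, rule finite_subset[OF _ finite_UnI[OF finite_support[of x] finite_support[of y]]]) auto

lemma coord_diff: "coord (x - y) i = coord x i - coord y i"
  unfolding minus_rvec_def
  by (rule coord_Abs_rvec, rule finite_subset[OF _ finite_UnI[OF finite_support[of x] finite_support[of y]]]) auto

lemma coord_uminus: "coord (- x) i = - coord x i"
  unfolding uminus_rvec_def by (rule coord_Abs_rvec) (simp add: finite_support)

lemma coord_scaleR: "coord (r *\<^sub>R x) i = r * coord x i"
  unfolding scaleR_rvec_def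
  by (rule coord_Abs_rvec, rule finite_subset[OF _ finite_support[of x]]) auto

instance
proof
  fix x y z :: rvec and a b :: real
  show "x + y + z = x + (y + z)" "x + y = y + x" "0 + x = x" "- x + x = 0" "x - y = x + - y"
    "a *\<^sub>R (x + y) = a *\<^sub>R x + a *\<^sub>R y" "(a + b) *\<^sub>R x = a *\<^sub>R x + b *\<^sub>R x"
    "a *\<^sub>R b *\<^sub>R x = (a * b) *\<^sub>R x" "1 *\<^sub>R x = x"
    by (rule rvec_eqI;
        simp add: coord_zero coord_add coord_diff coord_uminus coord_scaleR algebra_simps)+
qed

end

instantiation rvec :: real_inner
begin

definition "inner x y = (\<Sum>i | coord x i \<noteq> 0. coord x i * coord y i)"
definition "norm x = sqrt (inner x x)" for x :: rvec
definition "sgn x = x /\<^sub>R norm x" for x :: rvec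
definition "dist x y = norm (x - y)" for x y :: rvec
definition [code del]:
  "(uniformity :: (rvec \<times> rvec) filter) = (INF e\<in>{0<..}. principal {(x, y). dist x y < e})"
definition [code del]:
  "open (U :: rvec set) \<longleftrightarrow> (\<forall>x\<in>U. \<forall>\<^sub>F (x', y) in uniformity. x' = x \<longrightarrow> y \<in> U)"

lemma inner_rvec_superset:
  assumes "finite A" "{i. coord x i \<noteq> 0} \<subseteq> A"
  shows "inner x y = (\<Sum>i\<in>A. coord x i * coord y i)"
  unfolding inner_rvec_def using assms by (intro sum.mono_neutral_left) auto

instance
proof
  fix x y z :: rvec and r :: real
  let ?A = "{i. coord x i \<noteq> 0} \<union> {i. coord y i \<noteq> 0}"
  have fin: "finite ?A" by (simp add: finite_support)
  have ix: "inner x w = (\<Sum>i\<in>?A. coord x i * coord w i)" for w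
    by (rule inner_rvec_superset[OF fin]) auto
  have iy: "inner y w = (\<Sum>i\<in>?A. coord y i * coord w i)" for w
    by (rule inner_rvec_superset[OF fin]) auto
  show "inner x y = inner y x"
    unfolding ix iy by (simp add: mult.commute)
  have ixy: "inner (x + y) z = (\<Sum>i\<in>?A. coord (x + y) i * coord z i)"
    by (rule inner_rvec_superset[OF fin]) (auto simp: coord_add)
  show "inner (x + y) z = inner x z + inner y z"
    unfolding ix iy ixy by (simp add: coord_add algebra_simps sum.distrib)
  have irx: "inner (r *\<^sub>R x) y = (\<Sum>i\<in>?A. coord (r *\<^sub>R x) i * coord y i)"
    by (rule inner_rvec_superset[OF fin]) (auto simp: coord_scaleR)
  show "inner (r *\<^sub>R x) y = r * inner x y"
    unfolding ix irx by (simp add: coord_scaleR sum_distrib_left mult.assoc)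
  show "0 \<le> inner x x"
    unfolding inner_rvec_def by (intro sum_nonneg) simp
  show "inner x x = 0 \<longleftrightarrow> x = 0"
  proof
    assume "inner x x = 0"
    then have "\<forall>i\<in>{i. coord x i \<noteq> 0}. coord x i * coord x i = 0"
      unfolding inner_rvec_def by (subst (asm) sum_nonneg_eq_0_iff) (auto simp: finite_support)
    then show "x = 0" by (intro rvec_eqI) (auto simp: coord_zero)
  qed (simp add: inner_rvec_def coord_zero)
qed (rule norm_rvec_def sgn_rvec_def dist_rvec_def uniformity_rvec_def open_rvec_def)+

end

definition euclid :: "nat \<Rightarrow> rvec set" where
  "euclid d = {x. \<forall>i\<ge>d. coord x i = 0}"

lemma inner_euclid: "x \<in> euclid d \<Longrightarrow> inner x y = (\<Sum>i<d. coord x i * coord y i)"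
  by (rule inner_rvec_superset) (auto simp: euclid_def not_le[symmetric])

text \<open>
  A \<open>d \<times> d\<close> matrix is a function of which only the entries with both indices below \<open>d\<close> matter.
  As \<open>mat_vec d A\<close> ignores the coordinates from \<open>d\<close> on, its operator norm on the ambient space is
  the spectral norm of the \<open>d \<times> d\<close> matrix.
\<close>

type_synonym rmat = "nat \<Rightarrow> nat \<Rightarrow> real"

definition mat_vec :: "nat \<Rightarrow> rmat \<Rightarrow> rvec \<Rightarrow> rvec" where
  "mat_vec d A x = Abs_rvec (\<lambda>i. if i < d then \<Sum>j<d. A i j * coord x j else 0)"

lemma coord_mat_vec: "coord (mat_vec d A x) i = (if i < d then \<Sum>j<d. A i j * coord x j else 0)"
  unfolding mat_vec_def
  by (rule coord_Abs_rvec, rule finite_subset[of _ "{..<d}"]) (auto split: if_splits)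

definition mat_norm :: "nat \<Rightarrow> rmat \<Rightarrow> real" where
  "mat_norm d A = onorm (mat_vec d A)"


section \<open>Operators on a subset of Euclidean space\<close>

definition monotone_operator :: "rvec set \<Rightarrow> (rvec \<Rightarrow> rvec) \<Rightarrow> bool" where
  "monotone_operator X F \<longleftrightarrow> (\<forall>x\<in>X. \<forall>y\<in>X. 0 \<le> inner (F x - F y) (x - y))"

text \<open>
  \<open>DF\<close> is a Jacobian of \<open>F\<close> on \<open>X\<close>. The operator is only given on \<open>X\<close>, so the derivative is taken
  within \<open>X\<close>; if \<open>X\<close> has no interior in \<open>\<real>\<^sup>d\<close>, it need not be unique and \<open>DF\<close> is a choice of it.
\<close>

definition jacobian_on :: "nat \<Rightarrow> rvec set \<Rightarrow> (rvec \<Rightarrow> rvec) \<Rightarrow> (rvec \<Rightarrow> rmat) \<Rightarrow> bool" where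
  "jacobian_on d X F DF \<longleftrightarrow> (\<forall>x\<in>X. (F has_derivative mat_vec d (DF x)) (at x within X))"

definition smooth_operator ::
    "nat \<Rightarrow> rvec set \<Rightarrow> (rvec \<Rightarrow> rvec) \<Rightarrow> (rvec \<Rightarrow> rmat) \<Rightarrow> real \<Rightarrow> bool" where
  "smooth_operator d X F DF L \<longleftrightarrow> 0 \<le> L \<and> jacobian_on d X F DF \<and>
     (\<forall>x\<in>X. \<forall>y\<in>X. mat_norm d (\<lambda>i j. DF x i j - DF y i j) \<le> L * norm (x - y))"

definition inexact_jacobian ::
    "nat \<Rightarrow> rvec set \<Rightarrow> (rvec \<Rightarrow> rmat) \<Rightarrow> (rvec \<Rightarrow> rmat) \<Rightarrow> real \<Rightarrow> bool" where
  "inexact_jacobian d X DF J \<delta> \<longleftrightarrow>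
     (\<forall>v\<in>X. mat_norm d (\<lambda>i j. DF v i j - J v i j) \<le> \<delta>)"


section \<open>The algorithm VIJI\<close>

definition \<Psi> :: "nat \<Rightarrow> (rvec \<Rightarrow> rvec) \<Rightarrow> (rvec \<Rightarrow> rmat) \<Rightarrow> rvec \<Rightarrow> rvec \<Rightarrow> rvec" where
  "\<Psi> d F J v x = F v + mat_vec d (J v) (x - v)"

definition \<Omega> ::
    "nat \<Rightarrow> (rvec \<Rightarrow> rvec) \<Rightarrow> (rvec \<Rightarrow> rmat) \<Rightarrow> real \<Rightarrow> real \<Rightarrow> real \<Rightarrow> rvec \<Rightarrow> rvec \<Rightarrow> rvec" where
  "\<Omega> d F J L \<delta> \<eta> v x = \<Psi> d F J v x + (\<eta> * \<delta>) *\<^sub>R (x - v) + (5 * L * norm (x - v)) *\<^sub>R (x - v)"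

text \<open>
  \<open>VIJI_run\<close> states that the sequences \<open>s\<close>, \<open>v\<close>, \<open>x\<close>, \<open>\<lambda>\<close> record \<open>T\<close> iterations of the algorithm;
  \<open>v 0\<close>, \<open>\<lambda> 0\<close> and all values at indices above \<open>T\<close> are irrelevant. It is a relation because \<open>x\<close>
  and \<open>\<lambda>\<close> are not determined by the algorithm.
\<close>

definition VIJI_run ::
    "nat \<Rightarrow> rvec set \<Rightarrow> (rvec \<Rightarrow> rvec) \<Rightarrow> (rvec \<Rightarrow> rmat) \<Rightarrow> real \<Rightarrow> real \<Rightarrow> real \<Rightarrow> (nat \<Rightarrow> real) \<Rightarrow> nat \<Rightarrow>
     (nat \<Rightarrow> rvec) \<Rightarrow> (nat \<Rightarrow> rvec) \<Rightarrow> (nat \<Rightarrow> rvec) \<Rightarrow> (nat \<Rightarrow> real) \<Rightarrow> bool" where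
  "VIJI_run d X F J L \<delta> \<eta> \<beta> T s v x lam \<longleftrightarrow>
     x 0 \<in> X \<and> s 0 = 0 \<and>
     (\<forall>k<T.
        is_arg_max (\<lambda>u. inner (s k) (u - x 0) - 1/2 * (norm (u - x 0))\<^sup>2) (\<lambda>u. u \<in> X) (v (Suc k)) \<and>
        x (Suc k) \<in> X \<and>
        (SUP z\<in>X. inner (\<Omega> d F J L \<delta> \<eta> (v (Suc k)) (x (Suc k))) (x (Suc k) - z))
          \<le> L / 2 * norm (x (Suc k) - v (Suc k)) ^ 3 + \<delta> * (norm (x (Suc k) - v (Suc k)))\<^sup>2 \<and>
        1/32 \<le> lam (Suc k) * (L / 2 * norm (x (Suc k) - v (Suc k)) + \<beta> (Suc k)) \<and>
        lam (Suc k) * (L / 2 * norm (x (Suc k) - v (Suc k)) + \<beta> (Suc k)) \<le> 1/22 \<and>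
        s (Suc k) = s k - lam (Suc k) *\<^sub>R F (x (Suc k)))"

definition averaged_output :: "nat \<Rightarrow> (nat \<Rightarrow> rvec) \<Rightarrow> (nat \<Rightarrow> real) \<Rightarrow> rvec" where
  "averaged_output T x lam = (1 / (\<Sum>k=1..T. lam k)) *\<^sub>R (\<Sum>k=1..T. lam k *\<^sub>R x k)"

end

theory Submission
  imports Defs
begin

text \<open>
  Write \<open>r\<^sub>k = \<parallel>x\<^sub>k - v\<^sub>k\<parallel>\<close> and \<open>a\<^sub>k = L\<^sub>1/2 r\<^sub>k + \<delta>\<close>, so that step (3) of the algorithm keeps \<open>\<lambda>\<^sub>k a\<^sub>k\<close>
  between two absolute constants. Everything rests on this choice of scale: Taylor's formula bounds
  the model error \<open>\<parallel>F(x\<^sub>k) - \<Psi>(x\<^sub>k)\<parallel>\<close> by \<open>a\<^sub>k r\<^sub>k\<close>, the tolerance in the subproblem is exactly \<open>a\<^sub>k r\<^sub>k\<^sup>2\<close>,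
  and for \<open>\<eta> = 10\<close> the regularisation in \<open>\<Omega>\<close> at \<open>x\<^sub>k\<close> is exactly \<open>10 a\<^sub>k (x\<^sub>k - v\<^sub>k)\<close>. The
  regularisation therefore dominates both errors, and multiplying by \<open>\<lambda>\<^sub>k\<close> gives, for every \<open>u\<close> in \<open>X\<close>,
  \<open>\<lambda>\<^sub>k \<langle>F(x\<^sub>k), x\<^sub>k - u\<rangle> \<le> 1/2 \<parallel>u - v\<^sub>k\<parallel>\<^sup>2 - 3/32 r\<^sub>k\<^sup>2\<close> (lemmas \<open>regularized_step_arithmetic\<close> and \<open>VIJI_step\<close>).

  The term \<open>1/2 \<parallel>u - v\<^sub>k\<parallel>\<^sup>2\<close> is what strong concavity of the dual averaging objective pays for, so
  the steps telescope (lemma \<open>dual_averaging_regret\<close>) to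
  \<open>\<Sum> \<lambda>\<^sub>k \<langle>F(x\<^sub>k), x\<^sub>k - u\<rangle> + 3/32 \<Sum> r\<^sub>k\<^sup>2 \<le> 1/2 \<parallel>u - x\<^sub>0\<parallel>\<^sup>2 \<le> D\<^sup>2/2\<close>.

  Let \<open>G = \<langle>F(z), \<xi> - z\<rangle>\<close> with \<open>\<xi>\<close> the averaged output. By monotonicity the first sum for \<open>u = z\<close> is at
  least \<open>G \<Sum> \<lambda>\<^sub>k\<close>. Only the case \<open>G \<ge> 0\<close> is of interest, and then the inequality gives two bounds
  at once: \<open>G \<Sum> \<lambda>\<^sub>k \<le> D\<^sup>2/2\<close> and \<open>\<Sum> r\<^sub>k\<^sup>2 \<le> 16/3 D\<^sup>2\<close>. Small \<open>r\<^sub>k\<close>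
  force large \<open>\<lambda>\<^sub>k\<close>: Cauchy--Schwarz turns the second bound into a lower bound on \<open>\<Sum> \<lambda>\<^sub>k\<close>, and the rate follows (lemma \<open>gap_rate\<close>).
\<close>

section \<open>Taylor's formula on a convex set\<close>

text \<open>
  The derivative is taken within \<open>X\<close>, which may have empty interior, and the space need not be complete,
  so the remainder is not written as an integral. Pairing with the remainder \<open>w\<close> itself reduces the claim to
  the mean value theorem for a real function on \<open>[0, 1]\<close>, corrected by the quadratic that the
  Lipschitz bound on the derivative integrates to.
\<close>

lemma lipschitz_derivative_taylor_bound:
  fixes F :: "'a::real_normed_vector \<Rightarrow> 'b::real_inner"
  assumes X: "convex X" "v \<in> X" "x \<in> X"
    and D: "\<And>y. y \<in> X \<Longrightarrow> (F has_derivative F' y) (at y within X)"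
    and Lip: "\<And>y h. y \<in> X \<Longrightarrow> norm (F' y h - F' v h) \<le> L * norm (y - v) * norm h"
  shows "norm (F x - F v - F' v (x - v)) \<le> L / 2 * (norm (x - v))\<^sup>2"
proof -
  define p where "p t = v + t *\<^sub>R (x - v)" for t :: real
  define w where "w = F x - F v - F' v (x - v)"
  define M where "M = L * (norm (x - v))\<^sup>2 * norm w"
  define \<phi> where "\<phi> t = inner (F (p t) - t *\<^sub>R F' v (x - v)) w - M / 2 * t\<^sup>2" for t
  have pX: "p t \<in> X" if "t \<in> {0..1}" for t
  proof -
    have "p t = (1 - t) *\<^sub>R v + t *\<^sub>R x" by (simp add: p_def algebra_simps)
    then show ?thesis using convexD_alt[OF X] that by simp
  qed
  have der: "(\<phi> has_derivative
      (\<lambda>h. inner (F' (p t) (h *\<^sub>R (x - v)) - h *\<^sub>R F' v (x - v)) w - M * t * h)) (at t within {0..1})"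
    if t: "0 \<le> t" "t \<le> 1" for t
  proof -
    have "p ` {0..1} \<subseteq> X" using pX by auto
    then have DF: "(F has_derivative F' (p t)) (at (p t) within p ` {0..1})"
      using has_derivative_subset[OF D[OF pX[of t]]] t by simp
    have dp: "(p has_derivative (\<lambda>h. h *\<^sub>R (x - v))) (at t within {0..1})"
      unfolding p_def by (auto intro!: derivative_eq_intros)
    have DFp: "((\<lambda>t. F (p t)) has_derivative (\<lambda>h. F' (p t) (h *\<^sub>R (x - v)))) (at t within {0..1})"
      using diff_chain_within[OF dp DF] by (simp add: o_def)
    show ?thesis
      unfolding \<phi>_def by (rule derivative_eq_intros DFp refl | simp add: algebra_simps)+
  qed
  obtain t where t: "t \<in> {0<..<1::real}" and
    mvt: "\<phi> 1 - \<phi> 0 = inner (F' (p t) ((1 - 0) *\<^sub>R (x - v)) - (1 - 0) *\<^sub>R F' v (x - v)) w - M * t * (1 - 0)"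
    using mvt_simple[of 0 1 \<phi>, OF _ der] by auto
  have "inner (F' (p t) (x - v) - F' v (x - v)) w \<le> norm (F' (p t) (x - v) - F' v (x - v)) * norm w"
    by (rule norm_cauchy_schwarz)
  also have "\<dots> \<le> (L * norm (p t - v) * norm (x - v)) * norm w"
    using t by (intro mult_right_mono Lip pX) auto
  also have "\<dots> = M * t"
    using t by (simp add: M_def p_def power2_eq_square)
  finally have "\<phi> 1 - \<phi> 0 \<le> 0" using mvt by simp
  moreover have "\<phi> 1 - \<phi> 0 = inner w w - M / 2"
    by (simp add: \<phi>_def p_def w_def inner_diff_left)
  ultimately have "norm w * norm w \<le> L / 2 * (norm (x - v))\<^sup>2 * norm w"
    by (simp add: M_def dot_square_norm power2_eq_square)
  moreover have "0 \<le> L / 2 * (norm (x - v))\<^sup>2"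
  proof (cases "x = v")
    case False
    have "0 \<le> L * norm (x - v) * norm (x - v)"
      using Lip[of x "x - v"] X norm_ge_zero order_trans by blast
    then show ?thesis by (simp add: power2_eq_square mult.assoc)
  qed simp
  ultimately show ?thesis
    unfolding w_def[symmetric] by (cases "w = 0") auto
qed

section \<open>Matrices as bounded operators\<close>

lemma norm_rvec_L2_set:
  assumes "finite A" "{i. coord x i \<noteq> 0} \<subseteq> A"
  shows "norm x = L2_set (coord x) A"
  unfolding norm_rvec_def L2_set_def inner_rvec_superset[OF assms] by (simp add: power2_eq_square)

lemma abs_coord_le_norm: "\<bar>coord x i\<bar> \<le> norm x"
proof -
  have A: "finite (insert i {i. coord x i \<noteq> 0})" by (simp add: finite_support)
  have "norm x = L2_set (\<lambda>j. \<bar>coord x j\<bar>) (insert i {i. coord x i \<noteq> 0})"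
    by (subst norm_rvec_L2_set[OF A]) (auto simp: L2_set_def)
  then show ?thesis using member_le_L2_set[OF A, of i "\<lambda>j. \<bar>coord x j\<bar>"] by simp
qed

lemma bounded_linear_mat_vec: "bounded_linear (mat_vec d A)"
proof (rule bounded_linear_intro[where K = "\<Sum>i<d. \<Sum>j<d. \<bar>A i j\<bar>"])
  show "mat_vec d A (x + y) = mat_vec d A x + mat_vec d A y" for x y
    by (rule rvec_eqI) (simp add: coord_mat_vec coord_add algebra_simps sum.distrib)
  show "mat_vec d A (r *\<^sub>R x) = r *\<^sub>R mat_vec d A x" for r x
    by (rule rvec_eqI) (simp add: coord_mat_vec coord_scaleR sum_distrib_left mult_ac)
  show "norm (mat_vec d A x) \<le> norm x * (\<Sum>i<d. \<Sum>j<d. \<bar>A i j\<bar>)" for x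
  proof -
    have "norm (mat_vec d A x) = L2_set (coord (mat_vec d A x)) {..<d}"
      by (rule norm_rvec_L2_set) (auto simp: coord_mat_vec split: if_splits)
    also have "\<dots> \<le> (\<Sum>i<d. \<bar>coord (mat_vec d A x) i\<bar>)" by (rule L2_set_le_sum_abs)
    also have "\<dots> \<le> (\<Sum>i<d. \<Sum>j<d. norm x * \<bar>A i j\<bar>)"
    proof (rule sum_mono)
      fix i assume "i \<in> {..<d}"
      then have "\<bar>coord (mat_vec d A x) i\<bar> \<le> (\<Sum>j<d. \<bar>A i j * coord x j\<bar>)"
        by (simp add: coord_mat_vec sum_abs)
      also have "\<dots> \<le> (\<Sum>j<d. norm x * \<bar>A i j\<bar>)"
        by (intro sum_mono)
          (simp add: abs_mult mult.commute[of "norm x"] mult_left_mono abs_coord_le_norm)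
      finally show "\<bar>coord (mat_vec d A x) i\<bar> \<le> (\<Sum>j<d. norm x * \<bar>A i j\<bar>)" .
    qed
    finally show ?thesis by (simp add: sum_distrib_left)
  qed
qed

lemma mat_vec_diff: "mat_vec d (\<lambda>i j. A i j - B i j) h = mat_vec d A h - mat_vec d B h"
  by (rule rvec_eqI) (simp add: coord_mat_vec coord_diff left_diff_distrib sum_subtractf)

lemma norm_mat_vec_diff_le:
  assumes "mat_norm d (\<lambda>i j. A i j - B i j) \<le> c"
  shows "norm (mat_vec d A h - mat_vec d B h) \<le> c * norm h"
proof -
  have "norm (mat_vec d A h - mat_vec d B h) \<le> mat_norm d (\<lambda>i j. A i j - B i j) * norm h"
    unfolding mat_norm_def mat_vec_diff[symmetric]
    by (rule onorm[OF bounded_linear_mat_vec])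
  also have "\<dots> \<le> c * norm h" using assms by (rule mult_right_mono) simp
  finally show ?thesis .
qed

lemma inexact_model_error:
  assumes "convex X" "v \<in> X" "x \<in> X"
    and sm: "smooth_operator d X F DF L" and J: "inexact_jacobian d X DF J \<delta>"
  shows "norm (F x - \<Psi> d F J v x) \<le> (L / 2 * norm (x - v) + \<delta>) * norm (x - v)"
proof -
  have "norm (F x - F v - mat_vec d (DF v) (x - v)) \<le> L / 2 * (norm (x - v))\<^sup>2"
    using assms(1-3)
  proof (rule lipschitz_derivative_taylor_bound)
    show "(F has_derivative mat_vec d (DF y)) (at y within X)" if "y \<in> X" for y
      using sm that by (simp add: smooth_operator_def jacobian_on_def)
    show "norm (mat_vec d (DF y) h - mat_vec d (DF v) h) \<le> L * norm (y - v) * norm h"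
      if "y \<in> X" for y h
      using sm that assms(2) by (intro norm_mat_vec_diff_le) (simp add: smooth_operator_def)
  qed
  moreover have "norm (mat_vec d (DF v) (x - v) - mat_vec d (J v) (x - v)) \<le> \<delta> * norm (x - v)"
    using J assms(2) by (intro norm_mat_vec_diff_le) (simp add: inexact_jacobian_def)
  moreover have "F x - \<Psi> d F J v x = (F x - F v - mat_vec d (DF v) (x - v))
      + (mat_vec d (DF v) (x - v) - mat_vec d (J v) (x - v))"
    by (simp add: \<Psi>_def)
  ultimately show ?thesis
    using norm_triangle_ineq[of "F x - F v - mat_vec d (DF v) (x - v)"
        "mat_vec d (DF v) (x - v) - mat_vec d (J v) (x - v)"]
    by (simp add: power2_eq_square algebra_simps)
qed

section \<open>One iteration\<close>

text \<open>
  Polarisation \<open>2 \<langle>x - v, x - u\<rangle> = r\<^sup>2 + \<parallel>x - u\<parallel>\<^sup>2 - \<parallel>u - v\<parallel>\<^sup>2\<close>, with \<open>r = \<parallel>x - v\<parallel>\<close>, shows that the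
  regularisation of weight \<open>10 a\<close> costs \<open>5 a \<parallel>u - v\<parallel>\<^sup>2\<close> and gains \<open>5 a (r\<^sup>2 + \<parallel>x - u\<parallel>\<^sup>2)\<close>. The gain
  absorbs the tolerance \<open>a r\<^sup>2\<close> and the model error \<open>a r \<parallel>x - u\<parallel>\<close> with \<open>3 a r\<^sup>2\<close> to spare. The upper bound
  on \<open>\<lambda> a\<close> makes the cost at most \<open>1/2 \<parallel>u - v\<parallel>\<^sup>2\<close>; the lower bound keeps \<open>3/32 r\<^sup>2\<close> of the gain.
\<close>

lemma regularized_step_arithmetic:
  fixes x v u g m :: "'a::real_inner"
  assumes a: "0 \<le> a" "1/32 \<le> l * a" "l * a \<le> 1/22"
    and approx: "inner (m + (10 * a) *\<^sub>R (x - v)) (x - u) \<le> a * (norm (x - v))\<^sup>2"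
    and error: "norm (g - m) \<le> a * norm (x - v)"
  shows "l * inner g (x - u) \<le> 1/2 * (norm (u - v))\<^sup>2 - 3/32 * (norm (x - v))\<^sup>2"
proof -
  define r p q where "r = norm (x - v)" and "p = norm (x - u)" and "q = norm (u - v)"
  have polar: "2 * inner (x - v) (x - u) = r\<^sup>2 + p\<^sup>2 - q\<^sup>2"
    unfolding r_def p_def q_def power2_norm_eq_inner
    by (simp add: inner_diff_left inner_diff_right inner_commute)
  have "0 < l"
  proof (rule ccontr)
    assume "\<not> 0 < l"
    then have "l * a \<le> 0" using a(1) by (simp add: mult_nonpos_nonneg)
    then show False using a(2) by simp
  qed
  have "inner (g - m) (x - u) \<le> a * r * p"
    using norm_cauchy_schwarz[of "g - m" "x - u"] mult_right_mono[OF error, of p]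
    by (simp add: r_def p_def)
  with approx have "inner g (x - u) \<le> a * r\<^sup>2 + a * r * p - 10 * a * inner (x - v) (x - u)"
    by (simp add: inner_diff_left[of g] inner_add_left r_def)
  also have "\<dots> = a * (5 * q\<^sup>2 - (4 * r\<^sup>2 - r * p + 5 * p\<^sup>2))"
    using arg_cong[OF polar, of "\<lambda>t. 5 * a * t"] by (simp add: power2_eq_square algebra_simps)
  also have "\<dots> \<le> a * (5 * q\<^sup>2 - 3 * r\<^sup>2)"
  proof (rule mult_left_mono[OF _ a(1)])
    have "4 * r\<^sup>2 - r * p + 5 * p\<^sup>2 = 3 * r\<^sup>2 + (r - p / 2)\<^sup>2 + 19/4 * p\<^sup>2"
      by (simp add: power2_eq_square field_simps)
    then show "5 * q\<^sup>2 - (4 * r\<^sup>2 - r * p + 5 * p\<^sup>2) \<le> 5 * q\<^sup>2 - 3 * r\<^sup>2"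
      using zero_le_power2[of "r - p / 2"] zero_le_power2[of p] by linarith
  qed
  finally have "l * inner g (x - u) \<le> l * (a * (5 * q\<^sup>2 - 3 * r\<^sup>2))"
    using \<open>0 < l\<close> by simp
  also have "\<dots> = 5 * ((l * a) * q\<^sup>2) - 3 * ((l * a) * r\<^sup>2)" by (simp add: algebra_simps)
  also have "\<dots> \<le> 5 * (1/22 * q\<^sup>2) - 3 * (1/32 * r\<^sup>2)"
    using mult_right_mono[OF a(3), of "q\<^sup>2"] mult_right_mono[OF a(2), of "r\<^sup>2"] by simp
  also have "\<dots> \<le> 1/2 * q\<^sup>2 - 3/32 * r\<^sup>2" by simp
  finally show ?thesis by (simp add: r_def q_def)
qed

lemma VIJI_step:
  assumes X: "convex X" "bounded X" and sm: "smooth_operator d X F DF L"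
    and J: "0 \<le> \<delta>" "inexact_jacobian d X DF J \<delta>"
    and mem: "v \<in> X" "x \<in> X" "u \<in> X"
    and approx: "(SUP z\<in>X. inner (\<Omega> d F J L \<delta> 10 v x) (x - z))
      \<le> L / 2 * norm (x - v) ^ 3 + \<delta> * (norm (x - v))\<^sup>2"
    and l: "1/32 \<le> l * (L / 2 * norm (x - v) + \<delta>)" "l * (L / 2 * norm (x - v) + \<delta>) \<le> 1/22"
  shows "l * inner (F x) (x - u) \<le> 1/2 * (norm (u - v))\<^sup>2 - 3/32 * (norm (x - v))\<^sup>2"
proof (rule regularized_step_arithmetic[where m = "\<Psi> d F J v x"])
  define w where "w = \<Omega> d F J L \<delta> 10 v x"
  show "0 \<le> L / 2 * norm (x - v) + \<delta>"
    using sm J by (simp add: smooth_operator_def)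
  have "bdd_above ((\<lambda>z. inner w (x - z)) ` X)"
  proof (rule bdd_aboveI2)
    fix z assume "z \<in> X"
    then have "norm (x - z) \<le> diameter X"
      using diameter_bounded_bound[OF X(2) mem(2)] by (simp add: dist_norm)
    then show "inner w (x - z) \<le> norm w * diameter X"
      using norm_cauchy_schwarz[of w "x - z"] mult_left_mono[of "norm (x - z)" "diameter X" "norm w"]
      by simp
  qed
  then have "inner w (x - u) \<le> L / 2 * norm (x - v) ^ 3 + \<delta> * (norm (x - v))\<^sup>2"
    using cSUP_upper[OF mem(3), of "\<lambda>z. inner w (x - z)"] approx unfolding w_def by simp
  moreover have "w = \<Psi> d F J v x + (10 * (L / 2 * norm (x - v) + \<delta>)) *\<^sub>R (x - v)"
  proof -
    have "10 * (L / 2 * norm (x - v) + \<delta>) = 10 * \<delta> + 5 * L * norm (x - v)" by simp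
    then show ?thesis by (simp only: w_def \<Omega>_def scaleR_add_left add.assoc)
  qed
  ultimately show "inner (\<Psi> d F J v x + (10 * (L / 2 * norm (x - v) + \<delta>)) *\<^sub>R (x - v)) (x - u)
      \<le> (L / 2 * norm (x - v) + \<delta>) * (norm (x - v))\<^sup>2"
    by (simp add: power2_eq_square power3_eq_cube algebra_simps)
  show "norm (F x - \<Psi> d F J v x) \<le> (L / 2 * norm (x - v) + \<delta>) * norm (x - v)"
    by (rule inexact_model_error[OF X(1) mem(1,2) sm J(2)])
qed (rule l)+

section \<open>Dual averaging\<close>

text \<open>
  First-order optimality on the segment from \<open>v\<close> to \<open>u\<close>: moving a fraction \<open>t\<close> towards \<open>u\<close> cannot increase
  the objective, and letting \<open>t\<close> tend to \<open>0\<close> leaves the surplus \<open>1/2 \<parallel>u - v\<parallel>\<^sup>2\<close> that strong concavity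
  promises.
\<close>

lemma proximal_arg_max_three_point:
  fixes s c v u :: "'a::real_inner"
  assumes "convex X" "u \<in> X"
    and v: "is_arg_max (\<lambda>u. inner s (u - c) - 1/2 * (norm (u - c))\<^sup>2) (\<lambda>u. u \<in> X) v"
  shows "inner s (u - c) - 1/2 * (norm (u - c))\<^sup>2 + 1/2 * (norm (u - v))\<^sup>2
    \<le> inner s (v - c) - 1/2 * (norm (v - c))\<^sup>2"
proof -
  define g where "g = inner (s - (v - c)) (u - v)"
  define N where "N = (norm (u - v))\<^sup>2"
  have vX: "v \<in> X" using v by (simp add: is_arg_max_def)
  have expand: "inner s (v + t *\<^sub>R (u - v) - c) - 1/2 * (norm (v + t *\<^sub>R (u - v) - c))\<^sup>2
      = inner s (v - c) - 1/2 * (norm (v - c))\<^sup>2 + t * g - 1/2 * t\<^sup>2 * N" for t :: real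
  proof -
    have "v + t *\<^sub>R (u - v) - c = (v - c) + t *\<^sub>R (u - v)" by simp
    moreover have "(norm ((v - c) + t *\<^sub>R (u - v)))\<^sup>2
        = (norm (v - c))\<^sup>2 + 2 * t * inner (v - c) (u - v) + t\<^sup>2 * N"
      unfolding N_def power2_norm_eq_inner
      by (simp add: inner_add_left inner_add_right inner_commute power2_eq_square)
    ultimately show ?thesis
      unfolding g_def by (simp only: inner_add_right inner_scaleR_right inner_diff_left[of s] right_diff_distrib)
        (simp add: algebra_simps)
  qed
  have "g \<le> t / 2 * N" if t: "0 < t" "t \<le> 1" for t :: real
  proof -
    have "v + t *\<^sub>R (u - v) = (1 - t) *\<^sub>R v + t *\<^sub>R u" by (simp add: algebra_simps)
    then have "v + t *\<^sub>R (u - v) \<in> X" using convexD_alt[OF assms(1) vX assms(2)] t by simp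
    then have "t * g - 1/2 * t\<^sup>2 * N \<le> 0"
      using v expand[of t] by (fastforce simp: is_arg_max_def not_less)
    then have "t * g \<le> t * (t / 2 * N)" by (simp add: power2_eq_square)
    then show ?thesis using t by simp
  qed
  then have "\<forall>\<^sub>F t in at_right 0. g \<le> t / 2 * N"
    unfolding eventually_at_right_field by (intro exI[of _ 1]) auto
  moreover have "((\<lambda>t. t / 2 * N) \<longlongrightarrow> 0 / 2 * N) (at_right 0)"
    by (intro tendsto_intros) auto
  ultimately have "g \<le> 0 / 2 * N"
    by (intro tendsto_lowerbound[where F = "at_right (0::real)"]) auto
  then show ?thesis using expand[of 1] by (simp add: N_def)
qed

text \<open>
  The usual telescoping of the optimal values charges step \<open>k\<close> with the distance from \<open>v k\<close> to
  \<open>v (Suc k)\<close>, and for the last step this point is not part of the run. The bound is therefore proved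
  for all \<open>u\<close> in \<open>X\<close> together, so that an arbitrary \<open>u\<close> can take the place of the successor: the
  passage from \<open>k\<close> to \<open>Suc k\<close> uses the hypothesis at \<open>v (Suc k)\<close>, and the three point inequality for
  \<open>s k\<close> supplies the distance from there to \<open>u\<close>.
\<close>

lemma dual_averaging_regret:
  fixes s v x g :: "nat \<Rightarrow> 'a::real_inner"
  assumes X: "convex X" and s0: "s 0 = 0"
    and v: "\<And>k. k < T \<Longrightarrow>
      is_arg_max (\<lambda>u. inner (s k) (u - c) - 1/2 * (norm (u - c))\<^sup>2) (\<lambda>u. u \<in> X) (v (Suc k))"
    and s: "\<And>k. k < T \<Longrightarrow> s (Suc k) = s k - lam (Suc k) *\<^sub>R g (Suc k)"
    and step: "\<And>k u. k < T \<Longrightarrow> u \<in> X \<Longrightarrow>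
      lam (Suc k) * inner (g (Suc k)) (x (Suc k) - u) \<le> 1/2 * (norm (u - v (Suc k)))\<^sup>2 - e (Suc k)"
    and "u \<in> X"
  shows "(\<Sum>k=1..T. lam k * inner (g k) (x k - u)) + (\<Sum>k=1..T. e k) \<le> 1/2 * (norm (u - c))\<^sup>2"
proof -
  \<comment> \<open>\<open>s k\<close> is minus the weighted sum of the \<open>g j\<close>, so the iterates \<open>x j\<close> cancel on the right.\<close>
  have dual: "inner (s k) (u - c) = (\<Sum>j=1..k. lam j * inner (g j) (x j - u))
      - (\<Sum>j=1..k. lam j * inner (g j) (x j - c))" if "k \<le> T" for k u
    using that
  proof (induction k)
    case (Suc k)
    then show ?case by (simp add: s inner_diff_left inner_diff_right algebra_simps)
  qed (simp add: s0)
  have "(\<Sum>j=1..k. lam j * inner (g j) (x j - u)) + (\<Sum>j=1..k. e j) \<le> 1/2 * (norm (u - c))\<^sup>2"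
    if "k \<le> T" "u \<in> X" for k u
    using that
  proof (induction k arbitrary: u)
    case (Suc k)
    have k: "k < T" "k \<le> T" using Suc.prems by auto
    have vX: "v (Suc k) \<in> X" using v[OF k(1)] by (simp add: is_arg_max_def)
    show ?case
      using proximal_arg_max_three_point[OF X Suc.prems(2) v[OF k(1)]] Suc.IH[OF k(2) vX]
        step[OF k(1) Suc.prems(2)] dual[OF k(2), of u] dual[OF k(2), of "v (Suc k)"]
      by simp
  qed simp
  then show ?thesis using \<open>u \<in> X\<close> by blast
qed

lemma VIJI_regret:
  assumes X: "convex X" "bounded X" and sm: "smooth_operator d X F DF L"
    and J: "0 \<le> \<delta>" "inexact_jacobian d X DF J \<delta>"
    and run: "VIJI_run d X F J L \<delta> 10 (\<lambda>_. \<delta>) T s v x lam" and "u \<in> X"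
  shows "(\<Sum>k=1..T. lam k * inner (F (x k)) (x k - u)) + 3/32 * (\<Sum>k=1..T. (norm (x k - v k))\<^sup>2)
    \<le> 1/2 * (norm (u - x 0))\<^sup>2"
proof -
  have run': "s 0 = 0"
    "is_arg_max (\<lambda>u. inner (s k) (u - x 0) - 1/2 * (norm (u - x 0))\<^sup>2) (\<lambda>u. u \<in> X) (v (Suc k))"
    "x (Suc k) \<in> X"
    "(SUP z\<in>X. inner (\<Omega> d F J L \<delta> 10 (v (Suc k)) (x (Suc k))) (x (Suc k) - z))
          \<le> L / 2 * norm (x (Suc k) - v (Suc k)) ^ 3 + \<delta> * (norm (x (Suc k) - v (Suc k)))\<^sup>2"
    "1/32 \<le> lam (Suc k) * (L / 2 * norm (x (Suc k) - v (Suc k)) + \<delta>)"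
    "lam (Suc k) * (L / 2 * norm (x (Suc k) - v (Suc k)) + \<delta>) \<le> 1/22"
    "s (Suc k) = s k - lam (Suc k) *\<^sub>R F (x (Suc k))" if "k < T" for k
    using run that unfolding VIJI_run_def by blast+
  have s0: "s 0 = 0" using run by (simp add: VIJI_run_def)
  have vX: "v (Suc k) \<in> X" if "k < T" for k
    using run'(2)[OF that] by (simp add: is_arg_max_def)
  have "(\<Sum>k=1..T. lam k * inner (F (x k)) (x k - u)) + (\<Sum>k=1..T. 3/32 * (norm (x k - v k))\<^sup>2)
      \<le> 1/2 * (norm (u - x 0))\<^sup>2"
  proof (rule dual_averaging_regret[OF X(1) s0 run'(2) run'(7) _ \<open>u \<in> X\<close>])
    show "lam (Suc k) * inner (F (x (Suc k))) (x (Suc k) - u)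
        \<le> 1/2 * (norm (u - v (Suc k)))\<^sup>2 - 3/32 * (norm (x (Suc k) - v (Suc k)))\<^sup>2"
      if k: "k < T" and u: "u \<in> X" for k u
      by (rule VIJI_step[OF X sm J vX[OF k] run'(3)[OF k] u run'(4-6)[OF k]])
  qed
  then show ?thesis by (simp only: sum_distrib_left[symmetric])
qed

section \<open>Step sizes and the rate\<close>

text \<open>
  Cauchy--Schwarz for \<open>\<Sum> \<surd>\<lambda>\<^sub>k \<surd>a\<^sub>k\<close>, each summand of which is at least \<open>1/\<surd>32\<close>.
\<close>

lemma stepsize_sum_lower_bound:
  fixes lam a :: "nat \<Rightarrow> real"
  assumes "\<And>k. k \<in> {1..T} \<Longrightarrow> 0 \<le> lam k" "\<And>k. k \<in> {1..T} \<Longrightarrow> 0 \<le> a k"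
    and "\<And>k. k \<in> {1..T} \<Longrightarrow> 1/32 \<le> lam k * a k"
  shows "(real T)\<^sup>2 \<le> 32 * (\<Sum>k=1..T. lam k) * (\<Sum>k=1..T. a k)"
proof -
  have "real T * sqrt (1/32) = (\<Sum>k=1..T. sqrt (1/32))" by simp
  also have "\<dots> \<le> (\<Sum>k=1..T. sqrt (lam k) * sqrt (a k))"
    using assms(3) by (intro sum_mono) (simp add: real_sqrt_mult[symmetric])
  finally have "(real T * sqrt (1/32))\<^sup>2 \<le> (\<Sum>k=1..T. sqrt (lam k) * sqrt (a k))\<^sup>2"
    by (intro power_mono) auto
  also have "\<dots> \<le> (\<Sum>k=1..T. (sqrt (lam k))\<^sup>2) * (\<Sum>k=1..T. (sqrt (a k))\<^sup>2)"
    by (rule Cauchy_Schwarz_ineq_sum)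
  also have "\<dots> = (\<Sum>k=1..T. lam k) * (\<Sum>k=1..T. a k)"
    using assms(1,2) by simp
  finally show ?thesis by (simp add: power_mult_distrib power_divide)
qed

text \<open>
  The bound on \<open>\<Sum> r\<^sub>k\<^sup>2\<close> gives \<open>\<Sum> r\<^sub>k \<le> 7/3 D \<surd>T\<close>, where \<open>7/3\<close> is a rational upper bound for
  \<open>\<surd>(16/3)\<close>. Hence \<open>\<Sum> a\<^sub>k \<le> 7/6 L D \<surd>T + \<delta> T\<close>, and \<open>G T\<^sup>2\<close> is at most \<open>16 D\<^sup>2\<close> times this.
\<close>

lemma gap_rate:
  fixes lam r :: "nat \<Rightarrow> real"
  assumes T: "1 \<le> T" and nonneg: "0 \<le> L" "0 \<le> \<delta>" "0 \<le> D" "0 \<le> G" "\<And>k. 0 \<le> r k"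
    and lam: "\<And>k. k \<in> {1..T} \<Longrightarrow> 0 \<le> lam k"
      "\<And>k. k \<in> {1..T} \<Longrightarrow> 1/32 \<le> lam k * (L / 2 * r k + \<delta>)"
    and gap: "(\<Sum>k=1..T. lam k) * G \<le> D\<^sup>2 / 2"
    and disp: "(\<Sum>k=1..T. (r k)\<^sup>2) \<le> 16/3 * D\<^sup>2"
  shows "G \<le> 19 * (L * D ^ 3 / real T powr (3/2) + \<delta> * D\<^sup>2 / real T)"
proof -
  have "(\<Sum>k=1..T. 1 * r k)\<^sup>2 \<le> (\<Sum>k=1..T. 1\<^sup>2) * (\<Sum>k=1..T. (r k)\<^sup>2)"
    by (rule Cauchy_Schwarz_ineq_sum)
  also have "\<dots> \<le> real T * (16/3 * D\<^sup>2)" using mult_left_mono[OF disp, of "real T"] by simp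
  also have "\<dots> \<le> (7/3 * D * sqrt T)\<^sup>2"
    using mult_nonneg_nonneg[of "real T" "D\<^sup>2"] by (simp add: power_mult_distrib power_divide)
  finally have rsum: "(\<Sum>k=1..T. r k) \<le> 7/3 * D * sqrt T"
    using nonneg(3) by (simp only: mult_1) (rule power2_le_imp_le, simp_all)
  have "(\<Sum>k=1..T. L / 2 * r k + \<delta>) = L / 2 * (\<Sum>k=1..T. r k) + \<delta> * T"
    by (simp add: sum.distrib sum_distrib_left)
  also have "\<dots> \<le> L / 2 * (7/3 * D * sqrt T) + \<delta> * T"
    using mult_left_mono[OF rsum, of "L / 2"] nonneg by simp
  finally have asum: "(\<Sum>k=1..T. L / 2 * r k + \<delta>) \<le> 7/6 * L * D * sqrt T + \<delta> * T" by simp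
  have "G * (real T)\<^sup>2 \<le> G * (32 * (\<Sum>k=1..T. lam k) * (\<Sum>k=1..T. L / 2 * r k + \<delta>))"
    using lam nonneg by (intro mult_left_mono stepsize_sum_lower_bound) auto
  also have "\<dots> = 32 * (((\<Sum>k=1..T. lam k) * G) * (\<Sum>k=1..T. L / 2 * r k + \<delta>))"
    by (simp add: mult_ac)
  also have "\<dots> \<le> 32 * (D\<^sup>2 / 2 * (7/6 * L * D * sqrt T + \<delta> * T))"
    using nonneg gap asum by (intro mult_left_mono mult_mono sum_nonneg) auto
  also have "\<dots> = 56/3 * (L * D ^ 3 * sqrt T) + 16 * (\<delta> * D\<^sup>2 * T)"
    by (simp add: power2_eq_square power3_eq_cube algebra_simps)
  also have "\<dots> \<le> 19 * (L * D ^ 3 * sqrt T) + 19 * (\<delta> * D\<^sup>2 * T)"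
    using nonneg by (intro add_mono mult_right_mono) auto
  also have "\<dots> = 19 * (L * D ^ 3 * sqrt T + \<delta> * D\<^sup>2 * T)" by (rule distrib_left[symmetric])
  finally have "G \<le> 19 * (L * D ^ 3 * sqrt T + \<delta> * D\<^sup>2 * T) / (real T)\<^sup>2"
    using T by (simp add: pos_le_divide_eq)
  also have "\<dots> = 19 * (L * D ^ 3 * (sqrt T / (real T)\<^sup>2) + \<delta> * D\<^sup>2 * (T / (real T)\<^sup>2))"
    by (simp add: add_divide_distrib)
  also have "sqrt T / (real T)\<^sup>2 = 1 / real T powr (3/2)"
  proof -
    have "(real T)\<^sup>2 = sqrt T * real T powr (3/2)"
      using T by (simp add: powr_half_sqrt[symmetric] powr_add[symmetric] del: powr_half_sqrt)
    then show ?thesis using T by simp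
  qed
  also have "T / (real T)\<^sup>2 = 1 / real T" using T by (simp add: power2_eq_square)
  finally show ?thesis by simp
qed

section \<open>Convergence of VIJI\<close>


theorem theorem3p2:
  shows "\<exists>C>0::real. \<forall>(d::nat) (X::rvec set) (F::rvec \<Rightarrow> rvec) (DF::rvec \<Rightarrow> rmat) (J::rvec \<Rightarrow> rmat)
      (L\<^sub>1::real) (\<delta>::real) (T::nat) (s::nat \<Rightarrow> rvec) (v::nat \<Rightarrow> rvec) (x::nat \<Rightarrow> rvec) (lam::nat \<Rightarrow> real).
    X \<subseteq> euclid d \<longrightarrow> X \<noteq> {} \<longrightarrow> closed X \<longrightarrow> bounded X \<longrightarrow> convex X \<longrightarrow>
    F ` X \<subseteq> euclid d \<longrightarrow> continuous_on X F \<longrightarrow> monotone_operator X F \<longrightarrow>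
    smooth_operator d X F DF L\<^sub>1 \<longrightarrow>
    0 \<le> \<delta> \<longrightarrow> inexact_jacobian d X DF J \<delta> \<longrightarrow>
    1 \<le> T \<longrightarrow> VIJI_run d X F J L\<^sub>1 \<delta> 10 (\<lambda>_. \<delta>) T s v x lam \<longrightarrow>
    (SUP z\<in>X. inner (F z) (averaged_output T x lam - z))
      \<le> C * (L\<^sub>1 * diameter X ^ 3 / real T powr (3/2) + \<delta> * (diameter X)\<^sup>2 / real T)"
proof (intro exI[of _ "19::real"] conjI allI impI)
  fix d X F DF J L\<^sub>1 \<delta> T s v x lam
  assume "X \<noteq> {}" and X: "bounded X" "convex X"
    and mono: "monotone_operator X F" and sm: "smooth_operator d X F DF L\<^sub>1"
    and J: "0 \<le> \<delta>" "inexact_jacobian d X DF J \<delta>" and T: "1 \<le> T"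
    and run: "VIJI_run d X F J L\<^sub>1 \<delta> 10 (\<lambda>_. \<delta>) T s v x lam"
  define r where "r k = norm (x k - v k)" for k
  have L: "0 \<le> L\<^sub>1" using sm by (simp add: smooth_operator_def)
  have D: "0 \<le> diameter X" by (rule diameter_ge_0[OF X(1)])
  have step: "x k \<in> X" "1/32 \<le> lam k * (L\<^sub>1 / 2 * r k + \<delta>)" if k: "k \<in> {1..T}" for k
  proof -
    obtain j where "k = Suc j" "j < T" using k by (cases k) auto
    then show "x k \<in> X" "1/32 \<le> lam k * (L\<^sub>1 / 2 * r k + \<delta>)"
      using run unfolding VIJI_run_def r_def by blast+
  qed
  have lam: "0 < lam k" if k: "k \<in> {1..T}" for k
  proof (rule ccontr)
    assume "\<not> 0 < lam k"
    then have "lam k * (L\<^sub>1 / 2 * r k + \<delta>) \<le> 0"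
      using L J(1) by (intro mult_nonpos_nonneg) (auto simp: r_def)
    then show False using step(2)[OF k] by simp
  qed
  have lamsum: "0 < (\<Sum>k=1..T. lam k)" using T lam by (intro sum_pos) auto
  show "(SUP z\<in>X. inner (F z) (averaged_output T x lam - z))
      \<le> 19 * (L\<^sub>1 * diameter X ^ 3 / real T powr (3/2) + \<delta> * (diameter X)\<^sup>2 / real T)"
  proof (rule cSUP_least[OF \<open>X \<noteq> {}\<close>])
    fix z assume z: "z \<in> X"
    define G where "G = inner (F z) (averaged_output T x lam - z)"
    define S where "S = (\<Sum>k=1..T. lam k * inner (F (x k)) (x k - z))"
    have "(\<Sum>k=1..T. lam k) *\<^sub>R averaged_output T x lam = (\<Sum>k=1..T. lam k *\<^sub>R x k)"
      using lamsum by (simp add: averaged_output_def)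
    then have "(\<Sum>k=1..T. lam k) * G
        = inner (F z) ((\<Sum>k=1..T. lam k *\<^sub>R x k) - (\<Sum>k=1..T. lam k) *\<^sub>R z)"
      unfolding G_def by (metis inner_scaleR_right scaleR_diff_right)
    also have "\<dots> = (\<Sum>k=1..T. lam k * inner (F z) (x k - z))"
      by (simp add: inner_diff_right inner_sum_right sum_distrib_right sum_subtractf right_diff_distrib)
    also have "\<dots> \<le> S"
      unfolding S_def
    proof (intro sum_mono mult_left_mono)
      fix k assume k: "k \<in> {1..T}"
      then show "inner (F z) (x k - z) \<le> inner (F (x k)) (x k - z)"
        using mono step(1) z by (fastforce simp: monotone_operator_def inner_diff_left)
      show "0 \<le> lam k" using lam[OF k] by simp
    qed
    finally have GS: "(\<Sum>k=1..T. lam k) * G \<le> S" .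
    have "norm (z - x 0) \<le> diameter X"
      using diameter_bounded_bound[OF X(1) z, of "x 0"] run by (simp add: dist_norm VIJI_run_def)
    then have "(norm (z - x 0))\<^sup>2 \<le> (diameter X)\<^sup>2" by (simp add: power_mono)
    then have regret: "S + 3/32 * (\<Sum>k=1..T. (r k)\<^sup>2) \<le> (diameter X)\<^sup>2 / 2"
      using VIJI_regret[OF X(2,1) sm J run z] by (simp add: S_def r_def)
    show "G \<le> 19 * (L\<^sub>1 * diameter X ^ 3 / real T powr (3/2) + \<delta> * (diameter X)\<^sup>2 / real T)"
    proof (cases "0 \<le> G")
      case True
      have "0 \<le> S" using mult_nonneg_nonneg[OF less_imp_le[OF lamsum] True] GS by linarith
      then have disp: "(\<Sum>k=1..T. (r k)\<^sup>2) \<le> 16/3 * (diameter X)\<^sup>2" using regret by simp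
      have "0 \<le> (\<Sum>k=1..T. (r k)\<^sup>2)" by (intro sum_nonneg) simp
      then have gap: "(\<Sum>k=1..T. lam k) * G \<le> (diameter X)\<^sup>2 / 2" using GS regret by linarith
      show ?thesis
        by (rule gap_rate[OF T L J(1) D True _ less_imp_le[OF lam] step(2) gap disp])
          (auto simp: r_def)
    next
      case False
      moreover have "0 \<le> 19 * (L\<^sub>1 * diameter X ^ 3 / real T powr (3/2) + \<delta> * (diameter X)\<^sup>2 / real T)"
        using L J(1) D by simp
      ultimately show ?thesis by (simp only: not_le)
    qed
  qed
qed simp

end
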